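(* Let $(Y',\mathcal{O}')$ and $(Y'',\mathcal{O}'')$ be locally compact Hausdorff spaces and let $f:(X,\mathcal{O}_X)\to(Y',\mathcal{O}')\times(Y'',\mathcal{O}'')$ and $g:(Y',\mathcal{O}')\times(Y'',\mathcal{O}'')\to(Z,\mathcal{O}_Z)$ be continuous mappings which have compact continuations $$\widehat f:(\widehat X,\mathcal{O}_{\widehat X})\to\big[(Y',\mathcal{O}')\times(Y'',\mathcal{O}'')\big]_\infty,\qquad \tilde g:(Y',\mathcal{O}')_{\infty'}\times(Y'',\mathcal{O}'')_{\infty''}\to(\tilde Z,\mathcal{O}_{\tilde Z}).$$ If $\tilde g(\infty',y'')=\tilde g(y',\infty'')$ for all $y'\in Y'_{\infty'}$ and $y''\in Y''_{\infty''}$, then $h:=g\circ f$ has a compact continuation $\widehat h:(\widehat X,\mathcal{O}_{\widehat X})\to(\tilde Z,\mathcal{O}_{\tilde Z})$. If, in addition, $\widehat f[\widehat X\setminus X]\subseteq\{\infty\}$, then $\widehat h$ can be chosen such that $$\widehat h[\widehat X\setminus X]\subseteq\tilde g[\{\infty'\}\times Y'']\cup\tilde g[Y'\times\{\infty''\}]\cup\tilde g[\{(\infty',\infty'')\}].$$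
   Context: Products carry the product topology. The one-point compactification of a topological space $(Y,\mathcal{O})$ is $(Y,\mathcal{O})_\infty=(Y_\infty,\mathcal{O}_\infty)$ with $Y_\infty=Y\cup\{\infty\}$, $\infty\notin Y$, and $\mathcal{O}_\infty=\mathcal{O}\cup\{Y_\infty\setminus K: K\subseteq Y\text{ compact and closed}\}$; the added points of $Y'$, $Y''$ and $Y'\times Y''$ are denoted $\infty'$, $\infty''$ and $\infty$. (It is formed in the same way also if the space is already compact.) A space is locally compact if each point has a compact neighborhood. For a continuous mapping $f:(V,\mathcal{O})\to(V',\mathcal{O}')$, a compact continuation of $f$ is a continuous mapping $\widehat f:(\widehat V,\widehat{\mathcal{O}})\to(\widehat V',\widehat{\mathcal{O}}')$ with $\widehat f|_V=f$, where $(\widehat V,\widehat{\mathcal{O}})$ is a compact (not necessarily Hausdorff) space containing $(V,\mathcal{O})$ as a subspace and $(\widehat V',\widehat{\mathcal{O}}')$ is a topological space containing $(V',\mathcal{O}')$ as a subspace. *)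

theory Defs
  imports "HOL-Analysis.Analysis"
begin

text \<open>
  The library constant \<^const>\<open>Alexandroff_compactification\<close> is the one-point compactification
  for arbitrary topological spaces: the point \<open>y\<close> of \<open>Y\<close> is \<open>Some y\<close>, the added point is \<open>None\<close>,
  and the neighbourhoods of \<open>None\<close> are the complements of sets that are both compact and closed.

  Consequently ``contains as a subspace'' cannot always be literal inclusion, and the inclusion maps
  \<open>i\<close>, \<open>j\<close> are parameters below.  For \<open>i = id\<close> the literal notion of subspace is
  recovered, see \<open>embedding_map_id_iff\<close>.
\<close>

definition compact_continuation ::
  "('a \<Rightarrow> 'c) \<Rightarrow> ('b \<Rightarrow> 'd) \<Rightarrow> 'a topology \<Rightarrow> 'b topology \<Rightarrow> ('a \<Rightarrow> 'b)
    \<Rightarrow> 'c topology \<Rightarrow> 'd topology \<Rightarrow> ('c \<Rightarrow> 'd) \<Rightarrow> bool"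
  where "compact_continuation i j V V' f Vh Vh' fh \<longleftrightarrow>
    compact_space Vh \<and> embedding_map V Vh i \<and> embedding_map V' Vh' j \<and>
    continuous_map Vh Vh' fh \<and> (\<forall>v \<in> topspace V. fh (i v) = j (f v))"

lemma embedding_map_id_iff:
  "embedding_map V W id \<longleftrightarrow> topspace V \<subseteq> topspace W \<and> subtopology W (topspace V) = V"
proof
  assume "embedding_map V W id"
  then have h: "homeomorphic_map V (subtopology W (topspace V)) id"
    by (simp add: embedding_map_def)
  then have "subtopology W (topspace V) = V"
    by simp
  moreover from this have "topspace V \<subseteq> topspace W"
    by (metis inf.cobounded1 topspace_subtopology)
  ultimately show "topspace V \<subseteq> topspace W \<and> subtopology W (topspace V) = V"
    by blast
qed (simp add: embedding_map_def)

lemma embedding_map_map_prod_Some: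
  "embedding_map (prod_topology Y Y')
     (prod_topology (Alexandroff_compactification Y) (Alexandroff_compactification Y'))
     (map_prod Some Some)"
proof (rule injective_open_imp_embedding_map)
  let ?P = "prod_topology (Alexandroff_compactification Y) (Alexandroff_compactification Y')"
  show "continuous_map (prod_topology Y Y') ?P (map_prod Some Some)"
    unfolding map_prod_def continuous_map_prod_top by (simp add: continuous_map_Some)
  show "open_map (prod_topology Y Y') ?P (map_prod Some Some)"
    unfolding open_map_def
  proof (intro allI impI)
    fix U assume U: "openin (prod_topology Y Y') U"
    show "openin ?P (map_prod Some Some ` U)"
      unfolding openin_prod_topology_alt
    proof (intro allI impI)
      fix x y assume "(x, y) \<in> map_prod Some Some ` U"
      then obtain a b where ab: "(a, b) \<in> U" "x = Some a" "y = Some b"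
        by auto
      obtain A B where AB: "openin Y A" "openin Y' B" "a \<in> A" "b \<in> B" "A \<times> B \<subseteq> U"
        using U[unfolded openin_prod_topology_alt, rule_format, OF ab(1)] by auto
      have "Some ` A \<times> Some ` B = map_prod Some Some ` (A \<times> B)"
        by (simp add: map_prod_image)
      then have "Some ` A \<times> Some ` B \<subseteq> map_prod Some Some ` U"
        using AB(5) by (simp add: image_mono)
      then show "\<exists>U' V'. openin (Alexandroff_compactification Y) U' \<and>
          openin (Alexandroff_compactification Y') V' \<and> x \<in> U' \<and> y \<in> V' \<and>
          U' \<times> V' \<subseteq> map_prod Some Some ` U"
        using ab AB(1-4) by (intro exI[of _ "Some ` A"] exI[of _ "Some ` B"]) simp
    qed
  qed
qed (auto simp: inj_on_def)

end

theory Submission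
  imports Defs
begin

text \<open>
  The hypothesis on \<open>gt\<close> forces it to be constant on the whole cross
  \<open>{\<infinity>'} \<times> Y''\<^sub>\<infinity> \<union> Y'\<^sub>\<infinity> \<times> {\<infinity>''}\<close>.  Collapsing this cross to one point
  turns the product of the compactifications into the compactification of the product, so \<open>gt\<close>
  descends to a continuous map there, which can be composed with \<open>fh\<close>.
\<close>

text \<open>Only continuity at \<open>None\<close> needs an argument. The complement of an open set
  around \<open>c\<close> pulls back under \<open>k\<close> to a closed subset of a compact product;
  this set misses the cross, so it is a compact subset of the embedded copy of
  \<open>prod_topology X Y\<close>.\<close>

lemma continuous_map_Alexandroff_compactification_prod:
  assumes cont: "continuous_map
      (prod_topology (Alexandroff_compactification X) (Alexandroff_compactification Y)) Z k"
    and left: "\<And>y. y \<in> topspace (Alexandroff_compactification Y) \<Longrightarrow> k (None, y) = c"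
    and right: "\<And>x. x \<in> topspace (Alexandroff_compactification X) \<Longrightarrow> k (x, None) = c"
  shows "continuous_map (Alexandroff_compactification (prod_topology X Y)) Z
           (case_option c (k \<circ> map_prod Some Some))"
    (is "continuous_map ?A Z ?q")
proof -
  let ?P = "prod_topology (Alexandroff_compactification X) (Alexandroff_compactification Y)"
  let ?S = "map_prod Some Some :: 'a \<times> 'b \<Rightarrow> 'a option \<times> 'b option"
  have emb: "embedding_map (prod_topology X Y) ?P ?S"
    by (rule embedding_map_map_prod_Some)
  have cS: "continuous_map (prod_topology X Y) ?P ?S"
    using emb homeomorphic_imp_continuous_map continuous_map_into_fulltopology
    unfolding embedding_map_def by blast
  have ckS: "continuous_map (prod_topology X Y) Z (k \<circ> ?S)"
    using cS cont by (rule continuous_map_compose)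
  \<comment> \<open>\<open>None\<close> lies in every compactification, even of an empty space, so
    \<open>c\<close> is attained as \<open>k (None, None)\<close>.\<close>
  have cZ: "c \<in> topspace Z"
    using continuous_map_image_subset_topspace[OF cont] left[of None] by force
  have "openin ?A {p \<in> topspace ?A. ?q p \<in> U}" if U: "openin Z U" for U
  proof (cases "c \<in> U")
    \<comment> \<open>The preimage avoids \<open>None\<close>, and open sets of the base space stay
      open in its compactification.\<close>
    case False
    then have "{p \<in> topspace ?A. ?q p \<in> U} = Some ` {p \<in> topspace (prod_topology X Y). (k \<circ> ?S) p \<in> U}"
      by auto
    then show ?thesis
      using openin_continuous_map_preimage[OF ckS U] by simp
  next
    case True
    \<comment> \<open>\<open>?K\<close> is the set whose removal must leave a neighbourhood of
      \<open>None\<close>; \<open>?L\<close> is its counterpart in \<open>?P\<close>, where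
      compactness comes for free.\<close>
    let ?K = "{p \<in> topspace (prod_topology X Y). (k \<circ> ?S) p \<in> topspace Z - U}"
    let ?L = "{p \<in> topspace ?P. k p \<in> topspace Z - U}"
    have "closedin ?P ?L"
      using closedin_continuous_map_preimage[OF cont, of "topspace Z - U"] U by blast
    moreover have "compact_space ?P"
      by (simp add: compact_space_prod_topology)
    ultimately have "compactin ?P ?L"
      by (rule closedin_compact_space[rotated])
    moreover have "?L = ?S ` ?K"
    proof -
      have "p \<in> ?S ` ?K" if p: "p \<in> ?L" for p
      proof -
        obtain a b where "p = (a, b)"
          by fastforce
        \<comment> \<open>On the cross \<open>k\<close> takes the value \<open>c\<close>, which lies
          in \<open>U\<close>, whereas \<open>k p\<close> lies outside \<open>U\<close>.\<close>
        moreover from this p True left right have "a \<noteq> None" "b \<noteq> None"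
          by auto
        ultimately show ?thesis
          using p by (auto simp: image_iff)
      qed
      then show ?thesis
        by auto
    qed
    ultimately have "compactin ?P (?S ` ?K)"
      by simp
    \<comment> \<open>Compactness is intrinsic, so it passes to the image of the embedding and from
      there back along the homeomorphism.\<close>
    then have "compactin (subtopology ?P (?S ` topspace (prod_topology X Y))) (?S ` ?K)"
      unfolding compactin_subtopology by blast
    then have "compactin (prod_topology X Y) ?K"
      by (subst (asm) homeomorphic_map_compactness[OF emb[unfolded embedding_map_def]]) auto
    \<comment> \<open>Neighbourhoods of \<open>None\<close> require a complement that is closed as
      well as compact.\<close>
    moreover have "closedin (prod_topology X Y) ?K"
      using closedin_continuous_map_preimage[OF ckS, of "topspace Z - U"] U by blast
    moreover have "{p \<in> topspace ?A. ?q p \<in> U} = insert None (Some ` (topspace (prod_topology X Y) - ?K))"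
      using True continuous_map_image_subset_topspace[OF ckS] by auto
    ultimately show ?thesis
      unfolding openin_Alexandroff_compactification by blast
  qed
  moreover have "?q p \<in> topspace Z" if "p \<in> topspace ?A" for p
    using that cZ continuous_map_image_subset_topspace[OF ckS] by (force simp: image_subset_iff)
  ultimately show ?thesis
    unfolding continuous_map_def by blast
qed

theorem theorem2p6p5:
  fixes X Xh :: "'x topology"
    and Y' :: "'y1 topology" and Y'' :: "'y2 topology"
    and Z Zt :: "'z topology"
    and f :: "'x \<Rightarrow> 'y1 \<times> 'y2" and g :: "'y1 \<times> 'y2 \<Rightarrow> 'z"
    and fh :: "'x \<Rightarrow> ('y1 \<times> 'y2) option"
    and gt :: "'y1 option \<times> 'y2 option \<Rightarrow> 'z"
  assumes "locally_compact_space Y'" and "Hausdorff_space Y'"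
    and "locally_compact_space Y''" and "Hausdorff_space Y''"
    and "continuous_map X (prod_topology Y' Y'') f"
    and "continuous_map (prod_topology Y' Y'') Z g"
    and "compact_continuation id Some X (prod_topology Y' Y'') f
           Xh (Alexandroff_compactification (prod_topology Y' Y'')) fh"
    and "compact_continuation (map_prod Some Some) id (prod_topology Y' Y'') Z g
           (prod_topology (Alexandroff_compactification Y') (Alexandroff_compactification Y'')) Zt gt"
    and "\<forall>y' \<in> topspace (Alexandroff_compactification Y').
           \<forall>y'' \<in> topspace (Alexandroff_compactification Y''). gt (None, y'') = gt (y', None)"
  shows "(\<exists>hh. compact_continuation id id X Z (g \<circ> f) Xh Zt hh) \<and>
         (fh ` (topspace Xh - topspace X) \<subseteq> {None} \<longrightarrow>
           (\<exists>hh. compact_continuation id id X Z (g \<circ> f) Xh Zt hh \<and>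
             hh ` (topspace Xh - topspace X) \<subseteq>
               gt ` ({None} \<times> Some ` topspace Y'') \<union>
               gt ` (Some ` topspace Y' \<times> {None}) \<union>
               gt ` {(None, None)}))"
proof -
  define c where "c = gt (None, None)"
  \<comment> \<open>The map induced by \<open>gt\<close> after collapsing the cross to
    \<open>None\<close>, composed with \<open>fh\<close>.\<close>
  define hh where "hh = case_option c (gt \<circ> map_prod Some Some) \<circ> fh"
  note f = assms(7)[unfolded compact_continuation_def]
  note g = assms(8)[unfolded compact_continuation_def]
  \<comment> \<open>Fixing one of the two independent points in the hypothesis at
    \<open>None\<close> compares each arm of the cross with its corner.\<close>
  have left: "gt (None, y) = c" if "y \<in> topspace (Alexandroff_compactification Y'')" for y
    using assms(9)[rule_format, of None y] that by (simp add: c_def)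
  have right: "gt (x, None) = c" if "x \<in> topspace (Alexandroff_compactification Y')" for x
    using assms(9)[rule_format, of x None] that by (simp add: c_def)
  have "continuous_map (Alexandroff_compactification (prod_topology Y' Y'')) Zt
          (case_option c (gt \<circ> map_prod Some Some))"
    using g left right by (intro continuous_map_Alexandroff_compactification_prod) auto
  then have "continuous_map Xh Zt hh"
    unfolding hh_def using f continuous_map_compose by blast
  moreover have "hh v = g (f v)" if v: "v \<in> topspace X" for v
  proof -
    have "f v \<in> topspace (prod_topology Y' Y'')"
      using continuous_map_image_subset_topspace[OF assms(5)] v by blast
    moreover have "fh v = Some (f v)"
      using f v by simp
    ultimately show ?thesis
      using g by (auto simp: hh_def)
  qed
  ultimately have "compact_continuation id id X Z (g \<circ> f) Xh Zt hh"
    using f g by (simp add: compact_continuation_def)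
  \<comment> \<open>The same \<open>hh\<close> serves here: points that \<open>fh\<close> sends to
    \<open>None\<close> all go to the corner value \<open>c\<close>, which lies in the third set of
    the union.\<close>
  moreover have "hh ` (topspace Xh - topspace X) \<subseteq> gt ` {(None, None)}"
    if "fh ` (topspace Xh - topspace X) \<subseteq> {None}"
    using that by (auto simp: hh_def c_def)
  ultimately show ?thesis
    by blast
qed

end
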